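(* Let $q>0$, let $M=\{(x,\eta)\in\mathbb{R}^2:\eta>0\}$, and let $g_\epsilon:\mathbb{R}\to\mathbb{R}$, $\epsilon>0$, be smooth functions with $g_\epsilon(x)\to|x|$ pointwise as $\epsilon\downarrow0$. Consider the vector fields on $M$ $$A_0^\epsilon(x,\eta)=-\frac{x}{2\eta^2}\frac{\partial}{\partial x}+\Bigl(-q\eta+\frac{g_\epsilon(x)}{\sqrt{2\pi}}\Bigr)\frac{\partial}{\partial\eta},\qquad A_1(x,\eta)=\frac1\eta\frac{\partial}{\partial x}.$$ Then $A_0^\epsilon$ and $A_1$ satisfy Hörmander's hypoelliptic condition on $M$.
   Context: The functions $g_\epsilon$ are smooth approximations of $|x|$; they can be constructed by convolving $|x|$ with a mollifier, for example with $\frac{1}{\sqrt{2\pi}\,\epsilon}e^{-x^2/(2\epsilon^2)}$. For smooth vector fields $V,W$ on a smooth manifold $M$, the Lie bracket $[V,W]$ is the vector field given by $[V,W](f)=V(W(f))-W(V(f))$ for all $f\in C^\infty(M)$. Smooth vector fields $A_0,A_1,\dots,A_n$ on $M$ satisfy Hörmander's hypoelliptic condition if, for every $y\in M$, the vectors $$A_{j_0}(y),\ [A_{j_0},A_{j_1}](y),\ [[A_{j_0},A_{j_1}],A_{j_2}](y),\ \dots,\ [[\cdots[[A_{j_0},A_{j_1}],A_{j_2}],\cdots],A_{j_k}](y),$$ taken over $1\le j_0\le n$, $j_1,\dots,j_k\in\{0,1,\dots,n\}$ and $k\ge1$, span the tangent space of $M$ at $y$. Here $n=1$ and $A_0=A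_0^\epsilon$.
   Formalization: The claim fails if g_ε is constant near a point; the formal statement assumes in addition that at each x some derivative of g_ε of order ≥ 1 is nonzero (also necessary), and proves the claim without this extra assumption for the Gaussian mollification of |x|. *)

theory Defs
  imports "HOL-Probability.Probability"
begin

primrec Ck_on :: "nat \<Rightarrow> 'a::euclidean_space set \<Rightarrow> ('a \<Rightarrow> 'b::real_normed_vector) \<Rightarrow> bool" where
  "Ck_on 0 S f \<longleftrightarrow> continuous_on S f"
| "Ck_on (Suc k) S f \<longleftrightarrow>
     (\<forall>x\<in>S. f differentiable (at x)) \<and> (\<forall>v. Ck_on k S (\<lambda>x. frechet_derivative f (at x) v))"

(* All derivatives are taken with "at x", so this is the notion C^\<infinity> for open S only. *)
definition smooth_on :: "'a::euclidean_space set \<Rightarrow> ('a \<Rightarrow> 'b::real_normed_vector) \<Rightarrow> bool" where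
  "smooth_on S f \<longleftrightarrow> (\<forall>k. Ck_on k S f)"

(* The manifold M is an open subset of a Euclidean space 'a. Every tangent space is identified
   with 'a, and a vector field is a map V :: 'a => 'a of which only the values on M matter. *)
definition vf_apply :: "('a::euclidean_space \<Rightarrow> 'a) \<Rightarrow> ('a \<Rightarrow> real) \<Rightarrow> 'a \<Rightarrow> real" where
  "vf_apply V f y = frechet_derivative f (at y) (V y)"

(* At y, the bracket is the tangent vector u with u(f) = V(W f)(y) - W(V f)(y) for all smooth f
   on M. For open M, y in M and smooth V, W it exists and is unique: see lie_bracket_apply and
   lie_bracket_coord below. *)
definition lie_bracket ::
    "'a::euclidean_space set \<Rightarrow> ('a \<Rightarrow> 'a) \<Rightarrow> ('a \<Rightarrow> 'a) \<Rightarrow> 'a \<Rightarrow> 'a" where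
  "lie_bracket M V W y =
     (THE u. \<forall>f. smooth_on M f \<longrightarrow>
        frechet_derivative f (at y) u = vf_apply V (vf_apply W f) y - vf_apply W (vf_apply V f) y)"

abbreviation (input) "fderiv f x \<equiv> frechet_derivative f (at x)"

lemma smooth_onD:
  assumes "smooth_on S f"
  shows "x \<in> S \<Longrightarrow> (f has_derivative fderiv f x) (at x)" "smooth_on S (\<lambda>x. fderiv f x v)"
proof -
  have *: "Ck_on (Suc k) S f" for k using assms unfolding smooth_on_def by blast
  show "x \<in> S \<Longrightarrow> (f has_derivative fderiv f x) (at x)"
    using *[of 0] by (simp add: frechet_derivative_works)
  show "smooth_on S (\<lambda>x. fderiv f x v)" using * by (simp add: smooth_on_def)
qed

lemma has_field_line:
  fixes f :: "'a::euclidean_space \<Rightarrow> real"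
  assumes "(f has_derivative fderiv f (a + s *\<^sub>R v)) (at (a + s *\<^sub>R v))"
  shows "((\<lambda>s. f (a + s *\<^sub>R v)) has_real_derivative fderiv f (a + s *\<^sub>R v) v) (at s)"
proof -
  have 1: "((\<lambda>s. a + s *\<^sub>R v) has_derivative (\<lambda>t. t *\<^sub>R v)) (at s)"
    by (auto intro!: derivative_eq_intros)
  have lin: "linear (fderiv f (a + s *\<^sub>R v))"
    using assms has_derivative_linear by blast
  have "(\<lambda>t. fderiv f (a + s *\<^sub>R v) (t *\<^sub>R v)) = (*) (fderiv f (a + s *\<^sub>R v) v)"
    by (rule ext) (simp only: linear_scale[OF lin] real_scaleR_def mult.commute)
  then show ?thesis
    unfolding has_field_derivative_def using has_derivative_compose[OF 1 assms] by (simp only:)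
qed

lemma mixed_mvt:
  fixes f :: "'a::euclidean_space \<Rightarrow> real"
  assumes f: "smooth_on S f" and h: "h > 0"
    and sub: "\<And>s t. 0 \<le> s \<Longrightarrow> s \<le> h \<Longrightarrow> 0 \<le> t \<Longrightarrow> t \<le> h \<Longrightarrow> y + s *\<^sub>R v + t *\<^sub>R w \<in> S"
  obtains s t where "0 \<le> s" "s \<le> h" "0 \<le> t" "t \<le> h"
    "f (y + h *\<^sub>R v + h *\<^sub>R w) - f (y + h *\<^sub>R v) - f (y + h *\<^sub>R w) + f y =
     h * h * fderiv (\<lambda>x. fderiv f x v) (y + s *\<^sub>R v + t *\<^sub>R w) w"
proof -
  let ?G = "\<lambda>s. f ((y + h *\<^sub>R w) + s *\<^sub>R v) - f (y + s *\<^sub>R v)"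
  have "\<exists>z>0. z < h \<and> ?G h - ?G 0 = (h - 0) * (fderiv f ((y + h *\<^sub>R w) + z *\<^sub>R v) v - fderiv f (y + z *\<^sub>R v) v)"
  proof (rule MVT2[OF h])
    fix x assume x: "0 \<le> x" "x \<le> h"
    show "DERIV ?G x :> fderiv f ((y + h *\<^sub>R w) + x *\<^sub>R v) v - fderiv f (y + x *\<^sub>R v) v"
      using sub[of x h] sub[of x 0] x h
      by (intro DERIV_diff has_field_line smooth_onD(1)[OF f]) (auto simp: algebra_simps)
  qed
  then obtain s where s: "0 < s" "s < h"
    and G: "?G h - ?G 0 = h * (fderiv f ((y + h *\<^sub>R w) + s *\<^sub>R v) v - fderiv f (y + s *\<^sub>R v) v)" by auto
  let ?F = "\<lambda>t. fderiv f ((y + s *\<^sub>R v) + t *\<^sub>R w) v"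
  have "\<exists>z>0. z < h \<and> ?F h - ?F 0 = (h - 0) * fderiv (\<lambda>x. fderiv f x v) ((y + s *\<^sub>R v) + z *\<^sub>R w) w"
  proof (rule MVT2[OF h])
    fix x assume x: "0 \<le> x" "x \<le> h"
    show "DERIV ?F x :> fderiv (\<lambda>x. fderiv f x v) ((y + s *\<^sub>R v) + x *\<^sub>R w) w"
      using sub[of s x] x s
      by (intro has_field_line[where f="\<lambda>x. fderiv f x v"] smooth_onD(1)[OF smooth_onD(2)[OF f]]) auto
  qed
  then obtain t where t: "0 < t" "t < h"
    and F: "?F h - ?F 0 = h * fderiv (\<lambda>x. fderiv f x v) ((y + s *\<^sub>R v) + t *\<^sub>R w) w" by auto
  have "f (y + h *\<^sub>R v + h *\<^sub>R w) - f (y + h *\<^sub>R v) - f (y + h *\<^sub>R w) + f y = ?G h - ?G 0"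
    by (simp add: algebra_simps)
  also have "\<dots> = h * (?F h - ?F 0)" unfolding G by (simp add: algebra_simps)
  finally show thesis using that[of s t] s t unfolding F by simp
qed

lemma second_derivative_sym:
  fixes f :: "'a::euclidean_space \<Rightarrow> real"
  assumes f: "smooth_on S f" and S: "open S" and y: "y \<in> S"
  shows "fderiv (\<lambda>x. fderiv f x v) y w = fderiv (\<lambda>x. fderiv f x w) y v"
proof -
  let ?P = "\<lambda>x. fderiv (\<lambda>x. fderiv f x v) x w" and ?Q = "\<lambda>x. fderiv (\<lambda>x. fderiv f x w) x v"
  have cont: "isCont ?P y" "isCont ?Q y"
    by (rule has_derivative_continuous, rule smooth_onD(1)[OF smooth_onD(2)[OF smooth_onD(2)[OF f]] y])+
  obtain r where r: "r > 0" "ball y r \<subseteq> S" using S y by (meson open_contains_ball)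
  have "\<bar>?P y - ?Q y\<bar> \<le> e" if e: "e > 0" for e
  proof -
    obtain d1 where d1: "d1 > 0" "\<And>x. dist x y < d1 \<Longrightarrow> dist (?P x) (?P y) < e/2"
      using cont(1) e unfolding continuous_at_eps_delta by (meson half_gt_zero)
    obtain d2 where d2: "d2 > 0" "\<And>x. dist x y < d2 \<Longrightarrow> dist (?Q x) (?Q y) < e/2"
      using cont(2) e unfolding continuous_at_eps_delta by (meson half_gt_zero)
    define d where "d = min r (min d1 d2)"
    define h where "h = d / (norm v + norm w + 1)"
    have d: "d > 0" "d \<le> r" "d \<le> d1" "d \<le> d2" using r d1 d2 by (auto simp: d_def)
    have den: "norm v + norm w + 1 > 0" by (simp add: add_nonneg_pos)
    have h: "h > 0" using d den by (simp add: h_def)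
    have near: "dist (y + s *\<^sub>R v + t *\<^sub>R w) y < d"
      if "0 \<le> s" "s \<le> h" "0 \<le> t" "t \<le> h" for s t :: real
    proof -
      have "dist (y + s *\<^sub>R v + t *\<^sub>R w) y \<le> norm (s *\<^sub>R v) + norm (t *\<^sub>R w)"
        using norm_triangle_ineq[of "s *\<^sub>R v" "t *\<^sub>R w"] by (simp add: dist_norm add.assoc)
      also have "\<dots> \<le> h * norm v + h * norm w"
        using that by (intro add_mono) (auto intro: mult_right_mono)
      also have "\<dots> < h * (norm v + norm w + 1)" using h by (simp add: algebra_simps)
      also have "\<dots> = d" using den by (simp add: h_def)
      finally show ?thesis .
    qed
    have near': "dist (y + t *\<^sub>R w + s *\<^sub>R v) y < d"
      if "0 \<le> s" "s \<le> h" "0 \<le> t" "t \<le> h" for s t :: real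
      using near[OF that] by (simp add: algebra_simps)
    have inS: "x \<in> S" if "dist x y < d" for x
      using that d r by (auto simp: dist_commute subset_iff)
    obtain s t where st: "0 \<le> s" "s \<le> h" "0 \<le> t" "t \<le> h"
      and 1: "f (y + h *\<^sub>R v + h *\<^sub>R w) - f (y + h *\<^sub>R v) - f (y + h *\<^sub>R w) + f y =
         h * h * ?P (y + s *\<^sub>R v + t *\<^sub>R w)"
      by (rule mixed_mvt[OF f h, of y v w]) (rule inS, rule near, assumption+)
    obtain s' t' where st': "0 \<le> s'" "s' \<le> h" "0 \<le> t'" "t' \<le> h"
      and 2: "f (y + h *\<^sub>R w + h *\<^sub>R v) - f (y + h *\<^sub>R w) - f (y + h *\<^sub>R v) + f y =
         h * h * ?Q (y + s' *\<^sub>R w + t' *\<^sub>R v)"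
      by (rule mixed_mvt[OF f h, of y w v]) (rule inS, rule near', assumption+)
    have "h * h * ?P (y + s *\<^sub>R v + t *\<^sub>R w) = h * h * ?Q (y + s' *\<^sub>R w + t' *\<^sub>R v)"
      using 1 2 by (simp add: algebra_simps)
    then have "?P (y + s *\<^sub>R v + t *\<^sub>R w) = ?Q (y + s' *\<^sub>R w + t' *\<^sub>R v)" using h by simp
    moreover have "dist (?P (y + s *\<^sub>R v + t *\<^sub>R w)) (?P y) < e/2"
      using d1(2) near[OF st] d by auto
    moreover have "dist (?Q (y + s' *\<^sub>R w + t' *\<^sub>R v)) (?Q y) < e/2"
      using d2(2) near'[OF st'(3,4,1,2)] d by auto
    ultimately show ?thesis unfolding dist_real_def by linarith
  qed
  then have "\<bar>?P y - ?Q y\<bar> \<le> 0" by (rule field_le_epsilon) simp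
  then show ?thesis by simp
qed

lemma has_derivative_vf_apply:
  fixes f :: "'a::euclidean_space \<Rightarrow> real"
  assumes f: "smooth_on S f" and W: "smooth_on S W" and y: "y \<in> S" and S: "open S"
  shows "(vf_apply W f has_derivative (\<lambda>u. fderiv f y (fderiv W y u) + fderiv (\<lambda>x. fderiv f x (W y)) y u)) (at y)"
proof -
  have expand: "fderiv f x u = (\<Sum>b\<in>Basis. (u \<bullet> b) * fderiv f x b)" if "x \<in> S" for x u
  proof -
    have lin: "linear (fderiv f x)" using smooth_onD(1)[OF f that] has_derivative_linear by blast
    have "fderiv f x u = fderiv f x (\<Sum>b\<in>Basis. (u \<bullet> b) *\<^sub>R b)" by (simp add: euclidean_representation)
    also have "\<dots> = (\<Sum>b\<in>Basis. (u \<bullet> b) * fderiv f x b)"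
      by (simp add: linear_sum[OF lin] linear_scale[OF lin])
    finally show ?thesis .
  qed
  note DW = smooth_onD(1)[OF W y]
  note Db = smooth_onD(1)[OF smooth_onD(2)[OF f] y]
  have c: "fderiv (\<lambda>x. fderiv f x (W y)) y u = (\<Sum>b\<in>Basis. (W y \<bullet> b) * fderiv (\<lambda>x. fderiv f x b) y u)" for u
  proof -
    have "((\<lambda>x. \<Sum>b\<in>Basis. (W y \<bullet> b) * fderiv f x b) has_derivative
        (\<lambda>u. \<Sum>b\<in>Basis. (W y \<bullet> b) * fderiv (\<lambda>x. fderiv f x b) y u)) (at y)"
      by (intro has_derivative_sum has_derivative_mult_right Db)
    then have "((\<lambda>x. fderiv f x (W y)) has_derivative
        (\<lambda>u. \<Sum>b\<in>Basis. (W y \<bullet> b) * fderiv (\<lambda>x. fderiv f x b) y u)) (at y)"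
      by (rule has_derivative_transform_within_open[OF _ S y]) (rule expand[symmetric])
    from fun_cong[OF frechet_derivative_at[OF this]] show ?thesis by (rule sym)
  qed
  have "((\<lambda>x. \<Sum>b\<in>Basis. (W x \<bullet> b) * fderiv f x b) has_derivative
      (\<lambda>u. \<Sum>b\<in>Basis. (W y \<bullet> b) * fderiv (\<lambda>x. fderiv f x b) y u + (fderiv W y u \<bullet> b) * fderiv f y b)) (at y)"
    by (intro has_derivative_sum has_derivative_mult Db has_derivative_inner_left DW)
  then have "(vf_apply W f has_derivative
      (\<lambda>u. \<Sum>b\<in>Basis. (W y \<bullet> b) * fderiv (\<lambda>x. fderiv f x b) y u + (fderiv W y u \<bullet> b) * fderiv f y b)) (at y)"
    by (rule has_derivative_transform_within_open[OF _ S y])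
      (unfold vf_apply_def, rule expand[symmetric])
  moreover have "(\<Sum>b\<in>Basis. (W y \<bullet> b) * fderiv (\<lambda>x. fderiv f x b) y u + (fderiv W y u \<bullet> b) * fderiv f y b)
      = fderiv f y (fderiv W y u) + fderiv (\<lambda>x. fderiv f x (W y)) y u" for u
    unfolding c sum.distrib using expand[OF y, of "fderiv W y u"] by linarith
  ultimately show ?thesis by (simp only:)
qed

lemma smooth_inner: "smooth_on S (\<lambda>x. x \<bullet> b)"
proof -
  have const: "Ck_on k S (\<lambda>x. c)" for k and c :: real
    by (induction k arbitrary: c) auto
  have "fderiv (\<lambda>x. x \<bullet> b) x = (\<lambda>u. u \<bullet> b)" for x
    by (rule sym, rule frechet_derivative_at) (auto intro!: derivative_eq_intros)
  then have "Ck_on k S (\<lambda>x. x \<bullet> b)" for k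
    by (cases k) (auto simp: const intro!: continuous_intros derivative_intros)
  then show ?thesis by (simp add: smooth_on_def)
qed

lemma
  assumes M: "open M" and V: "smooth_on M V" and W: "smooth_on M W" and y: "y \<in> M"
  shows lie_bracket_coord: "lie_bracket M V W y = fderiv W y (V y) - fderiv V y (W y)"
    and lie_bracket_apply: "smooth_on M f \<Longrightarrow> fderiv f y (lie_bracket M V W y) =
      vf_apply V (vf_apply W f) y - vf_apply W (vf_apply V f) y"
proof -
  let ?u = "fderiv W y (V y) - fderiv V y (W y)"
  have ex: "fderiv f y ?u = vf_apply V (vf_apply W f) y - vf_apply W (vf_apply V f) y"
    if f: "smooth_on M f" for f
  proof -
    have lin: "linear (fderiv f y)" using smooth_onD(1)[OF f y] has_derivative_linear by blast
    show ?thesis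
      unfolding vf_apply_def[of V "vf_apply W f"] vf_apply_def[of W "vf_apply V f"]
      unfolding frechet_derivative_at[OF has_derivative_vf_apply[OF f W y M], symmetric]
        frechet_derivative_at[OF has_derivative_vf_apply[OF f V y M], symmetric]
      using second_derivative_sym[OF f M y, of "V y" "W y"] by (simp add: linear_diff[OF lin])
  qed
  have uniq: "u = u'" if "\<And>f. smooth_on M f \<Longrightarrow> fderiv f y u = (fderiv f y u' :: real)" for u u'
  proof (rule euclidean_eqI)
    fix b :: 'a
    have "fderiv (\<lambda>x. x \<bullet> b) y = (\<lambda>u. u \<bullet> b)"
      by (rule sym, rule frechet_derivative_at) (auto intro!: derivative_eq_intros)
    then show "u \<bullet> b = u' \<bullet> b" using that[OF smooth_inner[of M b]] by simp
  qed
  show *: "lie_bracket M V W y = ?u"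
    unfolding lie_bracket_def
    by (rule the_equality) (use ex in auto, rule uniq, use ex in auto)
  show "smooth_on M f \<Longrightarrow> fderiv f y (lie_bracket M V W y) =
      vf_apply V (vf_apply W f) y - vf_apply W (vf_apply V f) y"
    unfolding * by (rule ex)
qed

(* [[...[A j0, A j1], ...], A jk] for js = [j1, ..., jk]; it is A j0 itself for js = []. *)
definition iterated_bracket ::
    "'a::euclidean_space set \<Rightarrow> (nat \<Rightarrow> 'a \<Rightarrow> 'a) \<Rightarrow> nat \<Rightarrow> nat list \<Rightarrow> 'a \<Rightarrow> 'a" where
  "iterated_bracket M A j0 js = foldl (\<lambda>V j. lie_bracket M V (A j)) (A j0) js"

(* The smoothness of A 0, ..., A n is part of the condition. *)
definition hoermander_condition ::
    "'a::euclidean_space set \<Rightarrow> nat \<Rightarrow> (nat \<Rightarrow> 'a \<Rightarrow> 'a) \<Rightarrow> bool" where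
  "hoermander_condition M n A \<longleftrightarrow>
     (\<forall>j\<le>n. smooth_on M (A j)) \<and>
     (\<forall>y\<in>M. span {iterated_bracket M A j0 js y |j0 js. j0 \<in> {1..n} \<and> set js \<subseteq> {0..n}} = UNIV)"

definition half_plane :: "(real \<times> real) set" where
  "half_plane = {(x, \<eta>). \<eta> > 0}"

definition A0 :: "real \<Rightarrow> (real \<Rightarrow> real) \<Rightarrow> real \<times> real \<Rightarrow> real \<times> real" where
  "A0 q h = (\<lambda>(x, \<eta>). (- x / (2 * \<eta>\<^sup>2), - q * \<eta> + h x / sqrt (2 * pi)))"

definition A1 :: "real \<times> real \<Rightarrow> real \<times> real" where
  "A1 = (\<lambda>(x, \<eta>). (1 / \<eta>, 0))"

definition fields :: "real \<Rightarrow> (real \<Rightarrow> real) \<Rightarrow> nat \<Rightarrow> real \<times> real \<Rightarrow> real \<times> real" where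
  "fields q h j = (if j = 0 then A0 q h else A1)"

definition smooth_abs_approx :: "(real \<Rightarrow> real \<Rightarrow> real) \<Rightarrow> bool" where
  "smooth_abs_approx g \<longleftrightarrow>
     (\<forall>\<epsilon>>0. smooth_on UNIV (g \<epsilon>)) \<and> (\<forall>x. ((\<lambda>\<epsilon>. g \<epsilon> x) \<longlongrightarrow> \<bar>x\<bar>) (at_right 0))"

(* Smoothness and pointwise convergence to the absolute value alone do not give Hoermander's
   condition: if all derivatives of g \<epsilon> of positive order vanish at x (for instance, if g \<epsilon> is
   constant near x), then every iterated bracket is horizontal at (x, \<eta>). *)
definition nowhere_flat :: "(real \<Rightarrow> real) \<Rightarrow> bool" where
  "nowhere_flat h \<longleftrightarrow> (\<forall>x. \<exists>k\<ge>1. (deriv ^^ k) h x \<noteq> 0)"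

(* The convolution of the absolute value with the centred Gaussian density of standard
   deviation \<epsilon>. *)
definition gauss_abs :: "real \<Rightarrow> real \<Rightarrow> real" where
  "gauss_abs \<epsilon> x = (LINT y|lborel. \<bar>x - y\<bar> * normal_density 0 \<epsilon> y)"

end

theory Submission
  imports Defs
begin

text \<open>Since \<open>A\<^sub>1 = (1/\<eta>) \<partial>/\<partial>x\<close> is horizontal, bracketing with it on the right acts on
  \<open>\<eta>\<close>-components as \<open>- (1/\<eta>) \<partial>/\<partial>x\<close>. Hence \<open>[\<dots>[[A\<^sub>1, A\<^sub>0], A\<^sub>1], \<dots>, A\<^sub>1]\<close> with \<open>k - 1\<close> trailing
  copies of \<open>A\<^sub>1\<close> has \<open>\<eta>\<close>-component \<open>\<plusminus> h\<^sup>(\<^sup>k\<^sup>)(x) / (sqrt (2\<pi>) \<eta>\<^sup>k)\<close>, and at a point where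
  \<open>h\<^sup>(\<^sup>k\<^sup>)(x) \<noteq> 0\<close> it spans the plane together with \<open>A\<^sub>1\<close>. The mollified absolute value has second
  derivative twice the Gaussian density, which vanishes nowhere.\<close>

section \<open>Closure properties of C^k and smooth maps on open sets\<close>

lemma Ck_on_cong:
  fixes f g :: "'a::euclidean_space \<Rightarrow> 'b::real_normed_vector"
  assumes S: "open S"
  shows "(\<And>x. x \<in> S \<Longrightarrow> f x = g x) \<Longrightarrow> Ck_on k S f \<Longrightarrow> Ck_on k S g"
proof (induction k arbitrary: f g)
  case 0
  then show ?case by (auto cong: continuous_on_cong)
next
  case (Suc k)
  \<comment> \<open>Openness enters here: agreement on \<open>S\<close> is agreement near
    \<open>x\<close>, so the derivatives coincide.\<close>
  have D: "(g has_derivative fderiv f x) (at x)" if "x \<in> S" for x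
    using Suc.prems(2) that
    by (intro has_derivative_transform_within_open[OF _ S that Suc.prems(1)])
      (simp_all add: frechet_derivative_works)
  then have "fderiv f x = fderiv g x" if "x \<in> S" for x
    using frechet_derivative_at that by blast
  then have "Ck_on k S (\<lambda>x. fderiv g x v)" for v
    using Suc.IH[of "\<lambda>x. fderiv f x v" "\<lambda>x. fderiv g x v"] Suc.prems(2) by simp
  then show ?case by (simp add: differentiableI[OF D])
qed

text \<open>Lets an explicit formula \<open>D\<close>, required to be the derivative only on
  \<open>S\<close>, take the place of \<open>frechet_derivative\<close> in the recursion.\<close>

lemma Ck_on_SucI:
  assumes "open S" "\<And>x. x \<in> S \<Longrightarrow> (f has_derivative D x) (at x)"
    and "\<And>v. Ck_on k S (\<lambda>x. D x v)"
  shows "Ck_on (Suc k) S f"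
proof -
  have "fderiv f x = D x" if "x \<in> S" for x
    using frechet_derivative_at[OF assms(2)[OF that]] by simp
  then have "D x v = fderiv f x v" if "x \<in> S" for x v
    using that by simp
  then have "Ck_on k S (\<lambda>x. fderiv f x v)" for v
    by (rule Ck_on_cong[OF assms(1)]) (assumption, rule assms(3))
  then show ?thesis by (simp add: differentiableI[OF assms(2)])
qed

lemma Ck_on_SucD:
  assumes "Ck_on (Suc k) S f"
  shows "x \<in> S \<Longrightarrow> (f has_derivative fderiv f x) (at x)" "Ck_on k S (\<lambda>x. fderiv f x v)"
  using assms by (simp_all add: frechet_derivative_works)

text \<open>Product rules leave one factor undifferentiated, so their induction step has to lower
  the order of that factor.\<close>

lemma Ck_on_Suc_imp: "Ck_on (Suc k) S f \<Longrightarrow> Ck_on k S f"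
proof (induction k arbitrary: f)
  case 0
  then show ?case
    by (auto intro!: continuous_at_imp_continuous_on differentiable_imp_continuous_within)
qed auto

lemma smooth_on_cong:
  assumes "open S" "\<And>x. x \<in> S \<Longrightarrow> f x = g x" "smooth_on S f"
  shows "smooth_on S g"
  using assms Ck_on_cong unfolding smooth_on_def by blast

lemma smooth_on_const: "smooth_on S (\<lambda>x. c)"
proof -
  have "Ck_on k S (\<lambda>x. c)" for k
    by (induction k arbitrary: c) auto
  then show ?thesis by (simp add: smooth_on_def)
qed

lemma smooth_on_linear:
  assumes "bounded_linear L"
  shows "smooth_on S L"
proof -
  have D: "(L has_derivative L) (at x)" for x
    by (rule bounded_linear_imp_has_derivative[OF assms])
  have "Ck_on k S L" for k
  proof (cases k)
    case 0
    then show ?thesis by (simp add: linear_continuous_on[OF assms])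
  next
    case (Suc m)
    have "Ck_on m S (\<lambda>x. fderiv L x v)" for v
      using smooth_on_const[of S "L v"] by (simp add: frechet_derivative_at[OF D, symmetric] smooth_on_def)
    then show ?thesis by (simp add: Suc differentiableI[OF D])
  qed
  then show ?thesis by (simp add: smooth_on_def)
qed

lemma Ck_on_add:
  assumes S: "open S"
  shows "Ck_on k S f \<Longrightarrow> Ck_on k S g \<Longrightarrow> Ck_on k S (\<lambda>x. f x + g x)"
proof (induction k arbitrary: f g)
  case (Suc k)
  note f = Ck_on_SucD[OF Suc.prems(1)] and g = Ck_on_SucD[OF Suc.prems(2)]
  show ?case
    by (rule Ck_on_SucI[OF S has_derivative_add[OF f(1) g(1)]])
      (assumption, assumption, intro Suc.IH f(2) g(2))
qed (simp add: continuous_on_add)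

lemma smooth_on_add:
  assumes "open S" "smooth_on S f" "smooth_on S g"
  shows "smooth_on S (\<lambda>x. f x + g x)"
  using assms Ck_on_add unfolding smooth_on_def by blast

lemma Ck_on_scaleR:
  fixes f :: "'a::euclidean_space \<Rightarrow> real" and g :: "'a \<Rightarrow> 'b::real_normed_vector"
  assumes S: "open S"
  shows "Ck_on k S f \<Longrightarrow> Ck_on k S g \<Longrightarrow> Ck_on k S (\<lambda>x. f x *\<^sub>R g x)"
proof (induction k arbitrary: f g)
  case (Suc k)
  note f = Ck_on_SucD[OF Suc.prems(1)] Ck_on_Suc_imp[OF Suc.prems(1)]
  note g = Ck_on_SucD[OF Suc.prems(2)] Ck_on_Suc_imp[OF Suc.prems(2)]
  show ?case
    by (rule Ck_on_SucI[OF S has_derivative_scaleR[OF f(1) g(1)]])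
      (assumption, assumption, intro Ck_on_add[OF S] Suc.IH f(2,3) g(2,3))
qed (simp add: continuous_on_scaleR)

lemma smooth_on_scaleR:
  fixes f :: "'a::euclidean_space \<Rightarrow> real"
  assumes "open S" "smooth_on S f" "smooth_on S g"
  shows "smooth_on S (\<lambda>x. f x *\<^sub>R g x)"
  using assms Ck_on_scaleR unfolding smooth_on_def by blast

lemma smooth_on_mult:
  fixes f g :: "'a::euclidean_space \<Rightarrow> real"
  assumes "open S" "smooth_on S f" "smooth_on S g"
  shows "smooth_on S (\<lambda>x. f x * g x)"
  using smooth_on_scaleR[OF assms] by simp

lemma smooth_on_diff:
  assumes "open S" "smooth_on S f" "smooth_on S g"
  shows "smooth_on S (\<lambda>x. f x - g x)"
  using smooth_on_add[OF assms(1,2) smooth_on_scaleR[OF assms(1) smooth_on_const[of S "-1"] assms(3)]]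
  by simp

lemma smooth_on_sum:
  assumes "open S" "\<And>i. i \<in> I \<Longrightarrow> smooth_on S (f i)"
  shows "smooth_on S (\<lambda>x. \<Sum>i\<in>I. f i x)"
  using assms(2)
  by (induction I rule: infinite_finite_induct)
    (auto intro: smooth_on_const smooth_on_add[OF assms(1)])

lemma smooth_on_linear_compose:
  assumes L: "bounded_linear L" and S: "open S" and f: "smooth_on S f"
  shows "smooth_on S (\<lambda>x. L (f x))"
proof -
  have "Ck_on k S (\<lambda>x. L (f x))" if "Ck_on k S f" for k f
    using that
  proof (induction k arbitrary: f)
    case 0
    then show ?case using bounded_linear.continuous_on[OF L] by auto
  next
    case (Suc k)
    note f = Ck_on_SucD[OF Suc.prems]
    show ?case
      by (rule Ck_on_SucI[OF S bounded_linear.has_derivative[OF L f(1)]])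
        (assumption, intro Suc.IH f(2))
  qed
  with f show ?thesis by (simp add: smooth_on_def)
qed

text \<open>In direction \<open>v\<close> the derivative is that of \<open>f\<close> in the fixed
  direction \<open>L v\<close>, composed with \<open>L\<close>, so the induction hypothesis applies
  to it.\<close>

lemma smooth_on_compose_linear:
  fixes f :: "'b::euclidean_space \<Rightarrow> 'c::real_normed_vector"
  assumes L: "bounded_linear L" and f: "smooth_on UNIV f"
  shows "smooth_on UNIV (\<lambda>x. f (L x))"
proof -
  have "Ck_on k UNIV (\<lambda>x. f (L x))" if "Ck_on k UNIV f" for k and f :: "'b \<Rightarrow> 'c"
    using that
  proof (induction k arbitrary: f)
    case 0
    then show ?case
      using continuous_on_compose2[OF _ linear_continuous_on[OF L]] by auto
  next
    case (Suc k)
    note f = Ck_on_SucD[OF Suc.prems]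
    show ?case
      by (rule Ck_on_SucI[OF open_UNIV
            has_derivative_compose[OF bounded_linear_imp_has_derivative[OF L] f(1)[OF UNIV_I]]])
        (intro Suc.IH f(2))
  qed
  with f show ?thesis by (simp add: smooth_on_def)
qed

lemma smooth_on_subset:
  assumes "T \<subseteq> S" "smooth_on S f"
  shows "smooth_on T f"
proof -
  have "Ck_on k S f \<Longrightarrow> Ck_on k T f" for k
    using assms(1) by (induction k arbitrary: f) (auto intro: continuous_on_subset)
  with assms(2) show ?thesis by (simp add: smooth_on_def)
qed

text \<open>The derivative is a product of two copies of the reciprocal and
  \<open>- fderiv f x v\<close>, so order \<open>k\<close> of the reciprocal yields order
  \<open>k + 1\<close>.\<close>

lemma smooth_on_inverse:
  fixes f :: "'a::euclidean_space \<Rightarrow> real"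
  assumes S: "open S" and f: "smooth_on S f" and nz: "\<And>x. x \<in> S \<Longrightarrow> f x \<noteq> 0"
  shows "smooth_on S (\<lambda>x. inverse (f x))"
proof -
  have "Ck_on k S (\<lambda>x. inverse (f x))" for k
  proof (induction k)
    case 0
    have "Ck_on 0 S f" using f by (simp only: smooth_on_def)
    then show ?case using nz by (auto intro: continuous_on_inverse)
  next
    case (Suc k)
    have *: "Ck_on k S (\<lambda>x. - fderiv f x v)" for v
      using smooth_on_linear_compose[OF bounded_linear_minus[OF bounded_linear_ident] S smooth_onD(2)[OF f]]
      by (simp add: smooth_on_def)
    have "Ck_on k S (\<lambda>x. inverse (f x) *\<^sub>R inverse (f x) *\<^sub>R (- fderiv f x v))" for v
      by (intro Ck_on_scaleR S Suc.IH *)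
    then have D: "Ck_on k S (\<lambda>x. - (inverse (f x) * fderiv f x v * inverse (f x)))" for v
      by (simp add: mult_ac)
    show ?case
      by (rule Ck_on_SucI[OF S Deriv.has_derivative_inverse[OF nz smooth_onD(1)[OF f]] D])
  qed
  then show ?thesis by (simp add: smooth_on_def)
qed

lemma smooth_on_exp:
  fixes f :: "'a::euclidean_space \<Rightarrow> real"
  assumes S: "open S" and f: "smooth_on S f"
  shows "smooth_on S (\<lambda>x. exp (f x))"
proof -
  have "Ck_on k S (\<lambda>x. exp (f x))" for k
  proof (induction k)
    case 0
    have "Ck_on 0 S f" using f by (simp only: smooth_on_def)
    then show ?case by (auto intro: continuous_on_exp)
  next
    case (Suc k)
    have D: "((\<lambda>x. exp (f x)) has_derivative (\<lambda>v. exp (f x) *\<^sub>R fderiv f x v)) (at x)"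
      if "x \<in> S" for x
      using smooth_onD(1)[OF f that] by (auto intro!: derivative_eq_intros)
    show ?case
      using smooth_onD(2)[OF f]
      by (intro Ck_on_SucI[OF S D] Ck_on_scaleR S Suc.IH) (auto simp: smooth_on_def)
  qed
  then show ?thesis by (simp add: smooth_on_def)
qed

section \<open>Smooth functions of one real variable\<close>

lemma smooth_on_antiderivative:
  fixes f f' :: "real \<Rightarrow> real"
  assumes "\<And>x. (f has_real_derivative f' x) (at x)" and f': "smooth_on UNIV f'"
  shows "smooth_on UNIV f"
proof -
  \<comment> \<open>For fixed \<open>v\<close> the derivative is \<open>f' x * v\<close>, so order
    \<open>k\<close> of \<open>f'\<close> gives order \<open>k + 1\<close> of \<open>f\<close>;
    order 0 then follows from order 1.\<close>
  have Suc: "Ck_on (Suc k) UNIV f" for k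
  proof (rule Ck_on_SucI)
    show "(f has_derivative (\<lambda>v. f' x *\<^sub>R v)) (at x)" for x
      using assms(1)[of x] by (simp add: has_field_derivative_def)
    show "Ck_on k UNIV (\<lambda>x. f' x *\<^sub>R v)" for v
      using smooth_on_scaleR[OF open_UNIV f' smooth_on_const] unfolding smooth_on_def by blast
  qed simp
  show ?thesis unfolding smooth_on_def
    using Suc Ck_on_Suc_imp by blast
qed

text \<open>The line through 0 in direction 1 is the identity, so \<open>deriv h x\<close> is
  \<open>fderiv h x 1\<close>.\<close>

lemma smooth_on_real_derivative:
  fixes h :: "real \<Rightarrow> real"
  assumes "smooth_on UNIV h"
  shows "(h has_real_derivative deriv h x) (at x)" and "smooth_on UNIV (deriv h)"
proof -
  have D: "(h has_real_derivative fderiv h x 1) (at x)" for x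
    using has_field_line[of h 0 x 1] smooth_onD(1)[OF assms] by simp
  then have *: "deriv h x = fderiv h x 1" for x
    by (rule DERIV_imp_deriv)
  show "(h has_real_derivative deriv h x) (at x)"
    using D by (simp add: *)
  have "deriv h = (\<lambda>x. fderiv h x 1)" using * by auto
  then show "smooth_on UNIV (deriv h)" using smooth_onD(2)[OF assms] by simp
qed

lemma smooth_on_real_higher_deriv:
  fixes h :: "real \<Rightarrow> real"
  assumes "smooth_on UNIV h"
  shows "smooth_on UNIV ((deriv ^^ k) h)"
  by (induction k) (auto intro: assms smooth_on_real_derivative(2))

section \<open>Smoothness and components of Lie brackets\<close>

lemma smooth_on_fderiv_apply:
  fixes W V :: "'a::euclidean_space \<Rightarrow> 'a"
  assumes S: "open S" and W: "smooth_on S W" and V: "smooth_on S V"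
  shows "smooth_on S (\<lambda>x. fderiv W x (V x))"
proof (rule smooth_on_cong[OF S])
  \<comment> \<open>Smoothness is known for derivatives in fixed directions; expanding the moving
    direction \<open>V x\<close> in the basis reduces to these.\<close>
  show "smooth_on S (\<lambda>x. \<Sum>b\<in>Basis. (V x \<bullet> b) *\<^sub>R fderiv W x b)"
    by (intro smooth_on_sum smooth_on_scaleR S smooth_onD(2)[OF W]
        smooth_on_linear_compose[OF bounded_linear_inner_left S V])
  show "(\<Sum>b\<in>Basis. (V x \<bullet> b) *\<^sub>R fderiv W x b) = fderiv W x (V x)" if "x \<in> S" for x
  proof -
    have lin: "linear (fderiv W x)" using smooth_onD(1)[OF W that] has_derivative_linear by blast
    have "fderiv W x (V x) = fderiv W x (\<Sum>b\<in>Basis. (V x \<bullet> b) *\<^sub>R b)"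
      by (simp add: euclidean_representation)
    then show ?thesis
      by (simp add: linear_sum[OF lin] linear_scale[OF lin])
  qed
qed

text \<open>Follows from the coordinate formula. Iterated brackets thus stay smooth, and the formula
  applies again at each stage.\<close>

lemma smooth_on_lie_bracket:
  assumes M: "open M" and V: "smooth_on M V" and W: "smooth_on M W"
  shows "smooth_on M (lie_bracket M V W)"
  by (rule smooth_on_cong[OF M _ smooth_on_diff[OF M
        smooth_on_fderiv_apply[OF M W V] smooth_on_fderiv_apply[OF M V W]]])
    (rule lie_bracket_coord[OF M V W, symmetric])

text \<open>Only a formula for the second component is asked for, so the horizontal components of
  iterated brackets never have to be computed.\<close>

lemma snd_fderiv:
  assumes V: "smooth_on M V" and M: "open M" "y \<in> M"
    and r: "\<And>x. x \<in> M \<Longrightarrow> snd (V x) = r x" "(r has_derivative D) (at y)"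
  shows "snd (fderiv V y u) = D u"
proof -
  have "((\<lambda>x. snd (V x)) has_derivative (\<lambda>u. snd (fderiv V y u))) (at y)"
    by (intro has_derivative_snd smooth_onD(1)[OF V M(2)])
  then have "(r has_derivative (\<lambda>u. snd (fderiv V y u))) (at y)"
    by (rule has_derivative_transform_within_open[OF _ M]) (rule r)
  then show ?thesis
    using has_derivative_unique r(2) by metis
qed

section \<open>The two vector fields and their iterated brackets\<close>

lemma open_half_plane: "open half_plane"
proof -
  have "half_plane = {p. snd p > 0}" by (auto simp: half_plane_def)
  then show ?thesis using open_Collect_less[OF continuous_on_const continuous_on_snd[OF continuous_on_id]] by metis
qed

lemma smooth_A1: "smooth_on half_plane A1"
proof -
  have "smooth_on half_plane (\<lambda>p::real\<times>real. inverse (snd p) *\<^sub>R (1::real, 0::real))"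
    by (intro smooth_on_scaleR smooth_on_inverse smooth_on_linear smooth_on_const open_half_plane
        bounded_linear_snd) (auto simp: half_plane_def)
  moreover have "A1 = (\<lambda>p. inverse (snd p) *\<^sub>R (1, 0))"
    by (auto simp: A1_def fun_eq_iff inverse_eq_divide)
  ultimately show ?thesis by simp
qed

lemma smooth_A0:
  assumes "smooth_on UNIV h"
  shows "smooth_on half_plane (A0 q h)"
proof -
  have h: "smooth_on half_plane (\<lambda>p::real\<times>real. h (fst p))"
    using smooth_on_compose_linear[OF bounded_linear_fst assms] by (rule smooth_on_subset[rotated]) simp
  have "smooth_on half_plane (\<lambda>p::real\<times>real.
      ((- 1/2) * (fst p * (inverse (snd p) * inverse (snd p)))) *\<^sub>R (1::real, 0::real)
      + ((-q) * snd p + (1 / sqrt (2 * pi)) * h (fst p)) *\<^sub>R (0::real, 1::real))"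
    by (intro smooth_on_add smooth_on_scaleR smooth_on_mult smooth_on_inverse h
        smooth_on_linear[OF bounded_linear_fst] smooth_on_linear[OF bounded_linear_snd]
        smooth_on_const open_half_plane) (auto simp: half_plane_def)
  moreover have "A0 q h = (\<lambda>p. ((- 1/2) * (fst p * (inverse (snd p) * inverse (snd p)))) *\<^sub>R (1, 0)
      + ((-q) * snd p + (1 / sqrt (2 * pi)) * h (fst p)) *\<^sub>R (0, 1))"
    by (auto simp: A0_def fun_eq_iff field_simps power2_eq_square)
  ultimately show ?thesis by simp
qed

text \<open>The last index of the list is the outermost bracket, hence inductions from the right
  end.\<close>

lemma iterated_bracket_simps:
  "iterated_bracket M A j [] = A j"
  "iterated_bracket M A j (js @ [i]) = lie_bracket M (iterated_bracket M A j js) (A i)"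
  by (simp_all add: iterated_bracket_def)

lemma smooth_iterated_bracket:
  assumes "open M" "\<And>j. smooth_on M (A j)"
  shows "smooth_on M (iterated_bracket M A j js)"
  by (induction js rule: rev_induct)
    (auto simp: iterated_bracket_simps intro: smooth_on_lie_bracket assms)

text \<open>By \<open>lie_bracket_coord\<close>, \<open>[V, A1]\<close> is the derivative of
  \<open>A1\<close> along \<open>V\<close> minus that of \<open>V\<close> along \<open>A1\<close>.
  The former has second component 0, since \<open>snd (A1 p)\<close> is constantly 0.\<close>

lemma snd_bracket_A1:
  assumes V: "smooth_on half_plane V" and y: "(x, \<eta>) \<in> half_plane"
    and r: "\<And>p. p \<in> half_plane \<Longrightarrow> snd (V p) = r p" "(r has_derivative D) (at (x, \<eta>))"
  shows "snd (lie_bracket half_plane V A1 (x, \<eta>)) = - D (1/\<eta>, 0)"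
    and "snd (lie_bracket half_plane A1 V (x, \<eta>)) = D (1/\<eta>, 0)"
proof -
  have 0: "snd (fderiv A1 (x, \<eta>) u) = 0" for u
    by (rule snd_fderiv[OF smooth_A1 open_half_plane y, of "\<lambda>p. 0"]) (auto simp: A1_def)
  have "snd (fderiv V (x, \<eta>) (A1 (x, \<eta>))) = D (1/\<eta>, 0)"
    using snd_fderiv[OF V open_half_plane y r] by (simp add: A1_def)
  with 0 show "snd (lie_bracket half_plane V A1 (x, \<eta>)) = - D (1/\<eta>, 0)"
    "snd (lie_bracket half_plane A1 V (x, \<eta>)) = D (1/\<eta>, 0)"
    by (simp_all add: lie_bracket_coord[OF open_half_plane] V smooth_A1 y)
qed

text \<open>The leading 0 makes the first bracket \<open>[A1, A0]\<close>, with \<open>A1\<close> on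
  the left and hence no sign. Each of the \<open>m\<close> further brackets has \<open>A1\<close> on
  the right and contributes -1, a derivative of \<open>h\<close> and a factor
  \<open>1/\<eta>\<close>.\<close>

lemma snd_iterated_bracket:
  assumes h: "smooth_on UNIV h" and p: "p \<in> half_plane"
  shows "snd (iterated_bracket half_plane (fields q h) 1 (0 # replicate m 1) p) =
    (-1)^m * (deriv ^^ Suc m) h (fst p) * inverse (snd p) ^ Suc m / sqrt (2 * pi)"
  using p
proof (induction m arbitrary: p)
  case 0
  obtain x \<eta> where p: "p = (x, \<eta>)" by fastforce
  \<comment> \<open>The term with \<open>q\<close> multiplies \<open>snd u\<close>, which is 0 in
    the direction of \<open>A1\<close>.\<close>
  let ?D = "\<lambda>u::real\<times>real. - q * snd u + deriv h x * fst u / sqrt (2 * pi)"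
  have h': "(h has_derivative (\<lambda>u. deriv h x * u)) (at x)"
    using smooth_on_real_derivative(1)[OF h] by (simp add: has_field_derivative_def)
  have "((\<lambda>p. h (fst p)) has_derivative (\<lambda>u. deriv h x * fst u)) (at (x, \<eta>))"
    using has_derivative_compose[OF has_derivative_fst[OF has_derivative_ident], of h _ "(x, \<eta>)"] h'
    by simp
  then have "((\<lambda>p. - q * snd p + h (fst p) / sqrt (2 * pi)) has_derivative ?D) (at (x, \<eta>))"
    by (auto intro!: derivative_eq_intros simp: divide_inverse)
  then have "snd (lie_bracket half_plane A1 (A0 q h) (x, \<eta>)) = ?D (1/\<eta>, 0)"
    using 0 p
    by (intro snd_bracket_A1(2)[where r = "\<lambda>p. - q * snd p + h (fst p) / sqrt (2 * pi)"] smooth_A0 h)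
      (auto simp: A0_def)
  then show ?case
    by (simp add: p iterated_bracket_def fields_def inverse_eq_divide)
next
  case (Suc m)
  obtain x \<eta> where p: "p = (x, \<eta>)" by fastforce
  then have \<eta>: "\<eta> > 0" using Suc.prems by (simp add: half_plane_def)
  let ?V = "iterated_bracket half_plane (fields q h) 1 (0 # replicate m 1)"
  let ?r = "\<lambda>p::real\<times>real. (-1)^m * (deriv ^^ Suc m) h (fst p) * inverse (snd p) ^ Suc m / sqrt (2 * pi)"
  have V: "smooth_on half_plane ?V"
    by (intro smooth_iterated_bracket open_half_plane) (auto simp: fields_def smooth_A1 smooth_A0[OF h])
  have h': "((deriv ^^ Suc m) h has_derivative (\<lambda>u. (deriv ^^ Suc (Suc m)) h x * u)) (at x)"
    using smooth_on_real_derivative(1)[OF smooth_on_real_higher_deriv[OF h, of "Suc m"]]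
    by (simp add: has_field_derivative_def)
  have H: "((\<lambda>p. (deriv ^^ Suc m) h (fst p)) has_derivative
      (\<lambda>u. (deriv ^^ Suc (Suc m)) h x * fst u)) (at (x, \<eta>))"
    using has_derivative_compose[OF has_derivative_fst[OF has_derivative_ident],
        of "(deriv ^^ Suc m) h" _ "(x, \<eta>)"] h'
    by simp
  \<comment> \<open>The value of \<open>c\<close> is immaterial: it ends up multiplying
    \<open>snd u\<close>, and the derivative is evaluated at \<open>(1/\<eta>, 0)\<close>.\<close>
  obtain c where c: "((\<lambda>t. inverse t ^ Suc m) has_derivative (\<lambda>u. c * u)) (at \<eta>)"
    using DERIV_power[OF DERIV_inverse, of \<eta> "Suc m"] \<eta>
    unfolding has_field_derivative_def by blast
  have I: "((\<lambda>p. inverse (snd p) ^ Suc m) has_derivative (\<lambda>u. c * snd u)) (at (x, \<eta>))"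
    using has_derivative_compose[OF has_derivative_snd[OF has_derivative_ident],
        of "\<lambda>t. inverse t ^ Suc m" _ "(x, \<eta>)"] c
    by simp
  let ?D = "\<lambda>u::real\<times>real. ((deriv ^^ Suc m) h x * (c * snd u)
      + (deriv ^^ Suc (Suc m)) h x * fst u * inverse \<eta> ^ Suc m) * ((-1)^m / sqrt (2 * pi))"
  have "(?r has_derivative ?D) (at (x, \<eta>))"
    using has_derivative_mult_left[OF has_derivative_mult[OF H I], of "(-1)^m / sqrt (2 * pi)"]
    by (simp add: mult_ac)
  then have "snd (lie_bracket half_plane ?V A1 (x, \<eta>)) = - ?D (1/\<eta>, 0)"
    using Suc p by (intro snd_bracket_A1(1)[where r = ?r] V) auto
  moreover have "iterated_bracket half_plane (fields q h) 1 (0 # replicate (Suc m) 1)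
      = lie_bracket half_plane ?V A1"
    using iterated_bracket_simps(2)[of half_plane "fields q h" 1 "0 # replicate m 1" 1]
    by (simp add: replicate_append_same fields_def)
  ultimately show ?case
    by (simp add: p divide_inverse mult_ac)
qed

section \<open>Spanning the plane where some derivative of \<open>h\<close> is nonzero\<close>

lemma span_two_vectors_UNIV:
  fixes B :: "(real \<times> real) set"
  assumes "(a, 0) \<in> B" "a \<noteq> 0" "v \<in> B" "snd v \<noteq> 0"
  shows "span B = UNIV"
proof -
  have "w \<in> span B" for w
  proof -
    \<comment> \<open>The second coordinate dictates the coefficient of \<open>v\<close>; the
      remainder is horizontal.\<close>
    have "w = (snd w / snd v) *\<^sub>R v + ((fst w - snd w / snd v * fst v) / a) *\<^sub>R (a, 0)"
      using assms by (auto simp: prod_eq_iff)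
    also have "\<dots> \<in> span B"
      using assms by (intro span_add span_scale span_base)
    finally show ?thesis .
  qed
  then show ?thesis by auto
qed

lemma hoermander_condition_fields:
  assumes h: "smooth_on UNIV h" and flat: "nowhere_flat h"
  shows "hoermander_condition half_plane 1 (fields q h)"
  unfolding hoermander_condition_def
proof (intro conjI allI impI ballI)
  show "smooth_on half_plane (fields q h j)" for j
    by (simp add: fields_def smooth_A1 smooth_A0[OF h])
  fix y assume y: "y \<in> half_plane"
  obtain x \<eta> where xy: "y = (x, \<eta>)" "\<eta> > 0" using y by (auto simp: half_plane_def)
  obtain k where k: "k \<ge> 1" "(deriv ^^ k) h x \<noteq> 0"
    using flat by (auto simp: nowhere_flat_def)
  \<comment> \<open>\<open>[A1, A0]\<close> already supplies one derivative, so
    \<open>m = k - 1\<close> trailing copies of \<open>A1\<close> remain.\<close>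
  then obtain m where m: "k = Suc m" by (cases k) auto
  let ?B = "{iterated_bracket half_plane (fields q h) j0 js y |j0 js. j0 \<in> {1..1} \<and> set js \<subseteq> {0..1}}"
  let ?v = "iterated_bracket half_plane (fields q h) 1 (0 # replicate m 1) y"
  show "span ?B = UNIV"
  proof (rule span_two_vectors_UNIV)
    have "(1 / \<eta>, 0) = iterated_bracket half_plane (fields q h) 1 [] y"
      by (simp add: iterated_bracket_simps fields_def A1_def xy)
    then show "(1 / \<eta>, 0) \<in> ?B" by force
    have "set (0 # replicate m 1) \<subseteq> {0..1::nat}" by auto
    then show "?v \<in> ?B" by fastforce
    show "snd ?v \<noteq> 0"
      unfolding snd_iterated_bracket[OF h y] using k xy m by simp
  qed (use xy in auto)
qed

section \<open>The Gaussian mollification of the absolute value\<close>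

lemma DERIV_normal_density:
  assumes "\<sigma> > 0"
  shows "(normal_density 0 \<sigma> has_real_derivative - (x / \<sigma>\<^sup>2) * normal_density 0 \<sigma> x) (at x)"
proof -
  have "((\<lambda>x. exp (- x\<^sup>2 / (2 * \<sigma>\<^sup>2))) has_real_derivative
      - (x / \<sigma>\<^sup>2) * exp (- x\<^sup>2 / (2 * \<sigma>\<^sup>2))) (at x)"
    using assms by (auto intro!: derivative_eq_intros simp: field_simps eval_nat_numeral)
  from DERIV_cmult[OF this, of "1 / sqrt (2 * pi * \<sigma>\<^sup>2)"] show ?thesis
    unfolding normal_density_def[abs_def] by (simp add: mult_ac)
qed

lemma smooth_normal_density: "smooth_on UNIV (normal_density 0 \<sigma>)"
proof -
  have "smooth_on UNIV (\<lambda>x. (1 / sqrt (2 * pi * \<sigma>\<^sup>2)) * exp ((- 1 / (2 * \<sigma>\<^sup>2)) * (x * x)))"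
    by (intro smooth_on_mult smooth_on_exp smooth_on_const open_UNIV
        smooth_on_linear[OF bounded_linear_ident])
  then show ?thesis
    unfolding normal_density_def[abs_def] by (simp add: power2_eq_square)
qed

lemma integrable_abs_diff_normal_density:
  assumes "\<sigma> > 0"
  shows "integrable lborel (\<lambda>y. \<bar>x - y\<bar> * normal_density 0 \<sigma> y)"
proof (rule Bochner_Integration.integrable_bound)
  \<comment> \<open>The majorant comes from \<open>|x - y| \<le> |x| + |y|\<close>; its second
    summand is the integrand of the first absolute moment.\<close>
  show "integrable lborel (\<lambda>y. \<bar>x\<bar> * normal_density 0 \<sigma> y + normal_density 0 \<sigma> y * \<bar>y - 0\<bar> ^ 1)"
    by (intro Bochner_Integration.integrable_add integrable_mult_right integrable_normal_density
        integrable_normal_moment_abs assms)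
  have "\<bar>x - y\<bar> * normal_density 0 \<sigma> y \<le> (\<bar>x\<bar> + \<bar>y\<bar>) * normal_density 0 \<sigma> y" for y
    by (intro mult_right_mono) auto
  then show "AE y in lborel. norm (\<bar>x - y\<bar> * normal_density 0 \<sigma> y)
      \<le> norm (\<bar>x\<bar> * normal_density 0 \<sigma> y + normal_density 0 \<sigma> y * \<bar>y - 0\<bar> ^ 1)"
    by (intro AE_I2) (simp add: abs_mult algebra_simps)
qed simp

text \<open>The integral is reduced to compact intervals by
  \<open>\<bar>x - y\<bar> = \<bar>y\<bar> - x sgn y + 2 \<bar>x - y\<bar> 1\<^bsub>[0,x]\<^esub>(y)\<close>, where \<open>[0,x]\<close> means \<open>[x,0]\<close> if \<open>x < 0\<close>.\<close>

lemma gauss_abs_eq: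
  assumes "\<epsilon> > 0"
  obtains G c0 c1 where "\<And>x. (G has_real_derivative normal_density 0 \<epsilon> x) (at x)"
    and "\<And>x. gauss_abs \<epsilon> x = c0 - c1 * x + 2 * (x * G x + \<epsilon>\<^sup>2 * normal_density 0 \<epsilon> x)"
proof -
  let ?p = "normal_density 0 \<epsilon>"
  note D = DERIV_normal_density[OF assms]
  have cont: "isCont ?p x" for x using D DERIV_isCont by blast
  \<comment> \<open>\<open>G\<close> is fixed only up to a constant, which is why \<open>G 0\<close>
    appears below.\<close>
  obtain G where G: "\<And>x. (G has_real_derivative ?p x) (at x)"
    using einterval_antiderivative[of "-\<infinity>" "\<infinity>" ?p] cont
    by (auto simp: has_real_derivative_iff_has_vector_derivative)
  have abs: "integrable lborel (\<lambda>y. \<bar>y\<bar> * ?p y)"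
    using integrable_abs_diff_normal_density[OF assms, of 0] by simp
  have sgn: "integrable lborel (\<lambda>y. sgn y * ?p y)"
    by (rule Bochner_Integration.integrable_bound[OF integrable_normal_density[OF assms, of 0]])
      (auto simp: abs_mult sgn_real_def)
  let ?a = "LINT y|lborel. \<bar>y\<bar> * ?p y" and ?s = "LINT y|lborel. sgn y * ?p y"
  \<comment> \<open>This is the oriented integral of \<open>(x - y) * ?p y\<close> for
    \<open>y\<close> from 0 to \<open>x\<close>.\<close>
  let ?r = "\<lambda>x. x * G x + \<epsilon>\<^sup>2 * ?p x - x * G 0 - \<epsilon>\<^sup>2 * ?p 0"
  have "gauss_abs \<epsilon> x = ?a - x * ?s + 2 * ?r x" for x
  proof -
    \<comment> \<open>By the differential equation of the density,
      \<open>\<epsilon>\<^sup>2 * ?p y\<close> has derivative \<open>- y * ?p y\<close>.\<close>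
    have "((\<lambda>y. x * G y + \<epsilon>\<^sup>2 * ?p y) has_real_derivative (x - y) * ?p y) (at y)" for y
      using assms by (auto intro!: derivative_eq_intros D G simp: field_simps)
    note F = this DERIV_minus[OF this]
    \<comment> \<open>The point \<open>y = 0\<close> is excluded because the closed interval
      contains it: for \<open>x \<noteq> 0\<close> the right side would be twice the left there. It
      is a null set.\<close>
    have "\<exists>h. has_bochner_integral lborel h (?r x) \<and>
        (\<forall>y. y \<noteq> 0 \<longrightarrow> \<bar>x - y\<bar> * ?p y = \<bar>y\<bar> * ?p y - x * (sgn y * ?p y) + 2 * h y)"
    proof (cases "x \<ge> 0")
      case True
      have "has_bochner_integral lborel (\<lambda>y. ((x - y) * ?p y) * indicator {0..x} y) (?r x)"
        using has_bochner_integral_FTC_Icc_real[OF True F(1)] cont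
        by (simp add: algebra_simps)
      then show ?thesis
        using True by (intro exI conjI) (auto simp: sgn_real_def indicator_def algebra_simps)
    next
      case False
      then have "x \<le> 0" by simp
      \<comment> \<open>Orientation and sign of \<open>x - y\<close> are both reversed, so the value
        is again \<open>?r x\<close>.\<close>
      then have "has_bochner_integral lborel (\<lambda>y. (- ((x - y) * ?p y)) * indicator {x..0} y) (?r x)"
        using has_bochner_integral_FTC_Icc_real[OF _ F(2), of x 0] cont
        by (simp add: algebra_simps)
      then show ?thesis
        using False by (intro exI conjI) (auto simp: sgn_real_def indicator_def algebra_simps)
    qed
    then obtain h where h: "has_bochner_integral lborel h (?r x)"
      and eq: "\<And>y. y \<noteq> 0 \<Longrightarrow> \<bar>x - y\<bar> * ?p y = \<bar>y\<bar> * ?p y - x * (sgn y * ?p y) + 2 * h y"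
      by blast
    have [measurable]: "h \<in> borel_measurable borel"
      using has_bochner_integral_iff h borel_measurable_integrable by force
    have "gauss_abs \<epsilon> x = (LINT y|lborel. \<bar>y\<bar> * ?p y - x * (sgn y * ?p y) + 2 * h y)"
      unfolding gauss_abs_def
    proof (rule integral_cong_AE)
      show "AE y in lborel. \<bar>x - y\<bar> * ?p y = \<bar>y\<bar> * ?p y - x * (sgn y * ?p y) + 2 * h y"
        using AE_lborel_singleton[of 0] by eventually_elim (rule eq)
    qed simp_all
    also have "\<dots> = ?a - x * ?s + 2 * ?r x"
      using h abs sgn by (simp add: has_bochner_integral_iff)
    finally show ?thesis .
  qed
  \<comment> \<open>The affine part is collected into \<open>c0\<close> and \<open>c1\<close>, which
    do not affect the second derivative.\<close>
  then have "gauss_abs \<epsilon> x = (?a - 2 * \<epsilon>\<^sup>2 * ?p 0) - (?s + 2 * G 0) * x + 2 * (x * G x + \<epsilon>\<^sup>2 * ?p x)" for x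
    by (simp add: algebra_simps)
  with G show thesis by (rule that)
qed

text \<open>On differentiating
  \<open>x * G x + \<epsilon>\<^sup>2 * normal_density 0 \<epsilon> x\<close>, the terms with
  \<open>x\<close> times the density cancel and \<open>G\<close> remains, so \<open>g' x\<close> is
  \<open>2 * G x - c1\<close>.\<close>

lemma gauss_abs_second_derivative:
  assumes "\<epsilon> > 0"
  obtains g' where "\<And>x. (gauss_abs \<epsilon> has_real_derivative g' x) (at x)"
    and "\<And>x. (g' has_real_derivative 2 * normal_density 0 \<epsilon> x) (at x)"
proof -
  obtain G c0 c1 where G: "\<And>x. (G has_real_derivative normal_density 0 \<epsilon> x) (at x)"
    and eq: "\<And>x. gauss_abs \<epsilon> x = c0 - c1 * x + 2 * (x * G x + \<epsilon>\<^sup>2 * normal_density 0 \<epsilon> x)"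
    using gauss_abs_eq[OF assms] by blast
  show thesis
  proof
    show "(gauss_abs \<epsilon> has_real_derivative 2 * G x - c1) (at x)" for x
      unfolding eq[abs_def] using assms
      by (auto intro!: derivative_eq_intros DERIV_normal_density G simp: field_simps)
    show "((\<lambda>x. 2 * G x - c1) has_real_derivative 2 * normal_density 0 \<epsilon> x) (at x)" for x
      by (auto intro!: derivative_eq_intros G)
  qed
qed

lemma smooth_gauss_abs:
  assumes "\<epsilon> > 0"
  shows "smooth_on UNIV (gauss_abs \<epsilon>)"
proof -
  obtain g' where g: "\<And>x. (gauss_abs \<epsilon> has_real_derivative g' x) (at x)"
    and g': "\<And>x. (g' has_real_derivative 2 * normal_density 0 \<epsilon> x) (at x)"
    using gauss_abs_second_derivative[OF assms] by blast
  show ?thesis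
    by (intro smooth_on_antiderivative[OF g] smooth_on_antiderivative[OF g'] smooth_on_mult
        open_UNIV smooth_on_const smooth_normal_density)
qed

lemma nowhere_flat_gauss_abs:
  assumes "\<epsilon> > 0"
  shows "nowhere_flat (gauss_abs \<epsilon>)"
  unfolding nowhere_flat_def
proof
  fix x
  obtain g' where g: "\<And>x. (gauss_abs \<epsilon> has_real_derivative g' x) (at x)"
    and g': "\<And>x. (g' has_real_derivative 2 * normal_density 0 \<epsilon> x) (at x)"
    using gauss_abs_second_derivative[OF assms] by blast
  have "deriv (gauss_abs \<epsilon>) = g'" using g by (auto simp: fun_eq_iff intro: DERIV_imp_deriv)
  then have "(deriv ^^ 2) (gauss_abs \<epsilon>) x = 2 * normal_density 0 \<epsilon> x"
    using DERIV_imp_deriv[OF g'] by (simp add: eval_nat_numeral)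
  then show "\<exists>k\<ge>1. (deriv ^^ k) (gauss_abs \<epsilon>) x \<noteq> 0"
    using normal_density_pos[OF assms, of 0 x] by (intro exI[of _ 2]) auto
qed

text \<open>As the density has integral 1, \<open>|x|\<close> can be moved under the integral, where
  \<open>||x - y| - |x|| \<le> |y|\<close>. The bound is the first absolute moment.\<close>

lemma gauss_abs_approx:
  assumes "\<epsilon> > 0"
  shows "\<bar>gauss_abs \<epsilon> x - \<bar>x\<bar>\<bar> \<le> \<epsilon> * sqrt (2 / pi)"
proof -
  let ?p = "normal_density 0 \<epsilon>"
  note int = integrable_abs_diff_normal_density[OF assms]
    integrable_mult_right[OF integrable_normal_density[OF assms], of "\<bar>x\<bar>" 0]
  have "gauss_abs \<epsilon> x - \<bar>x\<bar> = (LINT y|lborel. \<bar>x - y\<bar> * ?p y - \<bar>x\<bar> * ?p y)"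
    using int assms by (simp add: gauss_abs_def)
  also have "\<bar>\<dots>\<bar> \<le> (LINT y|lborel. \<bar>0 - y\<bar> * ?p y)"
  proof (rule integral_abs_bound_integral)
    show "integrable lborel (\<lambda>y. \<bar>x - y\<bar> * ?p y - \<bar>x\<bar> * ?p y)"
      by (intro Bochner_Integration.integrable_diff int)
    show "\<bar>\<bar>x - y\<bar> * ?p y - \<bar>x\<bar> * ?p y\<bar> \<le> \<bar>0 - y\<bar> * ?p y" for y
    proof -
      have "\<bar>\<bar>x - y\<bar> * ?p y - \<bar>x\<bar> * ?p y\<bar> = \<bar>\<bar>x - y\<bar> - \<bar>x\<bar>\<bar> * ?p y"
        by (simp add: abs_mult left_diff_distrib[symmetric])
      also have "\<dots> \<le> \<bar>0 - y\<bar> * ?p y"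
        by (intro mult_right_mono) auto
      finally show ?thesis .
    qed
  qed (rule int)
  also have "\<dots> = \<epsilon> * sqrt (2 / pi)"
    using integral_normal_moment_abs_odd[OF assms, of 0 0] by (simp add: mult.commute)
  finally show ?thesis .
qed

lemma smooth_abs_approx_gauss_abs: "smooth_abs_approx gauss_abs"
  unfolding smooth_abs_approx_def
proof (intro conjI allI impI smooth_gauss_abs)
  fix x
  have lim: "((\<lambda>\<epsilon>. \<epsilon> * sqrt (2 / pi)) \<longlongrightarrow> 0) (at_right 0)"
    by (rule tendsto_mult_left_zero[OF tendsto_ident_at])
  \<comment> \<open>The filter \<open>at_right 0\<close> supplies the positivity of
    \<open>\<epsilon>\<close> that the bound assumes.\<close>
  have "\<forall>\<^sub>F \<epsilon> in at_right 0. norm (gauss_abs \<epsilon> x - \<bar>x\<bar>) \<le> \<epsilon> * sqrt (2 / pi)"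
    using eventually_at_right_less[of "0::real"]
    by eventually_elim (simp only: real_norm_def gauss_abs_approx)
  from Lim_null_comparison[OF this lim]
  have "((\<lambda>\<epsilon>. gauss_abs \<epsilon> x - \<bar>x\<bar>) \<longlongrightarrow> 0) (at_right 0)" .
  then show "((\<lambda>\<epsilon>. gauss_abs \<epsilon> x) \<longlongrightarrow> \<bar>x\<bar>) (at_right 0)"
    by (rule LIM_zero_cancel)
qed

text \<open>A smooth approximation of \<open>|x|\<close> may have flat points, hence the condition
  \<open>nowhere_flat\<close>. The Gaussian mollification shows that approximations with
  Hoermander's condition for every \<open>\<epsilon> > 0\<close> exist.\<close>

theorem lemma8:
  fixes q :: real
  assumes "q > 0"
  shows "(\<forall>g. smooth_abs_approx g \<longrightarrow>
            (\<forall>\<epsilon>>0. nowhere_flat (g \<epsilon>) \<longrightarrow>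
               hoermander_condition half_plane 1 (fields q (g \<epsilon>)))) \<and>
         smooth_abs_approx gauss_abs \<and>
         (\<forall>\<epsilon>>0. hoermander_condition half_plane 1 (fields q (gauss_abs \<epsilon>)))"
proof (intro conjI allI impI)
  fix g :: "real \<Rightarrow> real \<Rightarrow> real" and \<epsilon> :: real
  assume "smooth_abs_approx g" "\<epsilon> > 0" "nowhere_flat (g \<epsilon>)"
  then show "hoermander_condition half_plane 1 (fields q (g \<epsilon>))"
    by (intro hoermander_condition_fields) (simp_all add: smooth_abs_approx_def)
next
  fix \<epsilon> :: real
  assume "\<epsilon> > 0"
  then show "hoermander_condition half_plane 1 (fields q (gauss_abs \<epsilon>))"
    by (intro hoermander_condition_fields smooth_gauss_abs nowhere_flat_gauss_abs)
qed (rule smooth_abs_approx_gauss_abs)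

end
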